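(* Let $\omega_1,\dots,\omega_k>0$ be the (distinct) targeted harmonic frequencies and let $$S_{\mathrm{ref}}(s)=\frac{z(s)}{p(s)}=\frac{s\prod_{i=1}^k(s^2+\omega_i^2)\prod_{i=1}^m(s-z_i)}{\prod_{i=1}^n(s-p_i)},\qquad p_i\in\mathbb{C}^-,\ z_i\in\mathbb{C},$$ be the reference sensitivity. Let $\Sigma(A,B,C,D)$ be a minimal state-space realization of $S_{\mathrm{ref}}$ such that $\det(sI-A)=p(s)$ and $C(\mathrm{j}\omega_iI-A)^{-1}B=-D$ for $i=1,\dots,k$. Then, for a fixed output matrix $C$ and $D=1$, the filter $$F(s)=\frac{p(s)-z(s)}{p(s)}$$ that targets the harmonic frequencies $\omega_i$, $i=1,\dots,k$, with desired relative degree $n_r$ has a unique input matrix $B$ satisfying $$\begin{bmatrix} CA^{-1}\\ \Re\bigl(C(\mathrm{j}\omega_1I-A)^{-1}\bigr)\\ \Im\bigl(C(\mathrm{j}\omega_1I-A)^{-1}\bigr)\\ \vdots\\ \Re\bigl(C(\mathrm{j}\omega_kI-A)^{-1}\bigr)\\ \Im\bigl(C(\mathrm{j}\omega_kI-A)^{-1}\bigr)\end{bmatrix}_{(2k+1)\times n} B=\begin{bmatrix}1\\-1\\0\\ \vdots\\-1\\0\end{bmatrix}$$ and $$\begin{bmatrix} C\\ CA\\ \vdots\\ CA^{(n_r-2)}\end{bmatrix}_{m\times n}B=\begin{bmatrix}0\\0\\ \vdots\\0\end{bmatrix}.$$ Consequently, a state-space representation of the filter $F(s)$ is $\Sigma(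A,B,-C,0)$.
   Context: $\Sigma(A,B,C,D)$ denotes the single-input single-output state-space system $\dot x=Ax+Bu$, $y=Cx+Du$, with real matrices $A\in\mathbb{R}^{n\times n}$, $B\in\mathbb{R}^{n\times1}$, $C\in\mathbb{R}^{1\times n}$, $D\in\mathbb{R}$, whose transfer function is $C(sI-A)^{-1}B+D$. $\mathbb{C}^-$ is the open left half-plane and $\mathrm{j}$ is the imaginary unit. The number of auxiliary zeros is $m=n_r-1$ with $n_r\geq 1$, and $n=2k+1+m$ (with $D=1$, $S_{\mathrm{ref}}$ is biproper), so that the two displayed linear systems together consist of $n$ equations in the $n$ entries of $B$; for $n_r=1$ the second system is empty. The relative degree of a rational transfer function is the degree of its denominator minus the degree of its numerator. "Targets the frequencies" means that the zeros at $0$ and $\pm\mathrm{j}\omega_i$ of $S_{\mathrm{ref}}=1-F$ are imposed, i.e. $S_{\mathrm{ref}}(0)=S_{\mathrm{ref}}(\mathrm{j}\omega_i)=0$ for $i=1,\dots,k$. *)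

theory Defs
  imports
    "Jordan_Normal_Form.Char_Poly"
    "Jordan_Normal_Form.Gauss_Jordan_Elimination"
begin

text \<open>Matrices over \<open>nat\<close>-valued dimensions are used because minimality of a realization
  quantifies over realizations of all state dimensions.\<close>

abbreviation cmat :: "real mat \<Rightarrow> complex mat" where
  "cmat \<equiv> map_mat complex_of_real"

text \<open>Unspecified if \<open>M\<close> is singular.\<close>

definition mat_inv :: "'a :: field mat \<Rightarrow> 'a mat" where
  "mat_inv M = the (mat_inverse M)"

definition sI_minus :: "complex \<Rightarrow> real mat \<Rightarrow> complex mat" where
  "sI_minus s A = s \<cdot>\<^sub>m 1\<^sub>m (dim_row A) - cmat A"

definition C_resolvent :: "real mat \<Rightarrow> real mat \<Rightarrow> complex \<Rightarrow> complex mat" where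
  "C_resolvent C A s = cmat C * mat_inv (sI_minus s A)"

definition siso_system :: "nat \<Rightarrow> real mat \<Rightarrow> real mat \<Rightarrow> real mat \<Rightarrow> bool" where
  "siso_system n A B C \<longleftrightarrow>
     A \<in> carrier_mat n n \<and> B \<in> carrier_mat n 1 \<and> C \<in> carrier_mat 1 n"

definition transfer_function ::
  "real mat \<Rightarrow> real mat \<Rightarrow> real mat \<Rightarrow> real \<Rightarrow> complex \<Rightarrow> complex" where
  "transfer_function A B C D s = (C_resolvent C A s * cmat B) $$ (0, 0) + complex_of_real D"

text \<open>Equality of rational functions: both sides agree outside the finitely many points at which
  one of the two expressions is undefined.\<close>

definition realization ::
  "nat \<Rightarrow> real mat \<Rightarrow> real mat \<Rightarrow> real mat \<Rightarrow> real \<Rightarrow> complex poly \<Rightarrow> complex poly \<Rightarrow> bool" where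
  "realization n A B C D num den \<longleftrightarrow>
     siso_system n A B C \<and>
     (\<forall>s. det (sI_minus s A) \<noteq> 0 \<and> poly den s \<noteq> 0 \<longrightarrow>
          transfer_function A B C D s = poly num s / poly den s)"

definition minimal_realization ::
  "nat \<Rightarrow> real mat \<Rightarrow> real mat \<Rightarrow> real mat \<Rightarrow> real \<Rightarrow> complex poly \<Rightarrow> complex poly \<Rightarrow> bool" where
  "minimal_realization n A B C D num den \<longleftrightarrow>
     realization n A B C D num den \<and>
     (\<forall>n' A' B' C' D'. realization n' A' B' C' D' num den \<longrightarrow> n \<le> n')"

definition relative_degree :: "complex poly \<Rightarrow> complex poly \<Rightarrow> int" where
  "relative_degree num den = int (degree den) - int (degree num)"

definition targets_frequencies :: "nat \<Rightarrow> (nat \<Rightarrow> real) \<Rightarrow> (complex \<Rightarrow> complex) \<Rightarrow> bool" where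
  "targets_frequencies k \<omega> F \<longleftrightarrow>
     1 - F 0 = 0 \<and> (\<forall>i\<in>{1..k}. 1 - F (\<i> * complex_of_real (\<omega> i)) = 0)"

text \<open>The stacked coefficient matrices and right-hand side of the two linear systems; the state
  dimension is \<open>dim_row A\<close>.\<close>

definition interpolation_matrix :: "nat \<Rightarrow> (nat \<Rightarrow> real) \<Rightarrow> real mat \<Rightarrow> real mat \<Rightarrow> real mat" where
  "interpolation_matrix k \<omega> A C =
     mat_of_rows (dim_row A)
       (row (C * mat_inv A) 0 #
        concat (map (\<lambda>i. let G = C_resolvent C A (\<i> * complex_of_real (\<omega> i))
                         in [row (map_mat Re G) 0, row (map_mat Im G) 0]) [1..<k+1]))"

definition interpolation_rhs :: "nat \<Rightarrow> real mat" where
  "interpolation_rhs k =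
     mat_of_cols (2*k+1) [vec_of_list (1 # concat (map (\<lambda>i. [-1, 0]) [1..<k+1]))]"

definition markov_matrix :: "nat \<Rightarrow> real mat \<Rightarrow> real mat \<Rightarrow> real mat" where
  "markov_matrix m A C = mat_of_rows (dim_row A) (map (\<lambda>j. row (C * (A ^\<^sub>m j)) 0) [0..<m])"

end

(* For an input column v, the function p(s) C (sI - A)^-1 v is a polynomial q_v of degree below n, and
   C A^j v = 0 for all j < l exactly when degree q_v + l < n or q_v = 0.  Since q_B = z - p, the
   relative degree gives the Markov equations for B, and the interpolation equations are read off
   from the zeros of z.  The difference v of two solutions has degree q_v <= 2k by the Markov
   equations, while q_v vanishes at 0 and at the points +-j omega_i; so q_v = 0, hence C A^j v = 0 for
   every j, and minimality (observability) forces v = 0. *)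

theory Submission
  imports Defs
begin

text \<open>Existence needs no inversion of the stacked n x n matrix: the given B already solves
  both systems, so only the homogeneous problem has to be shown to have trivial kernel. The counts
  match because n - m = 2k + 1: m Markov equations leave a numerator of degree at most 2k, one less
  than the number of prescribed zeros. Only k + 1 of these zeros are imposed directly; the
  conjugates come from A, C and v being real. All of them lie on the imaginary axis, where p has no
  root, so the resolvent exists there and a zero of the transfer function is a zero of the
  numerator. The other obstacle is that minimality speaks only about state dimensions. Observability
  therefore has to be extracted by building a smaller realization explicitly out of a linear
  dependence between the rows C A^i.\<close>

section \<open>Inverses of nonsingular matrices\<close>

lemma mat_inv:
  assumes "A \<in> carrier_mat n n" and "det A \<noteq> 0"
  shows "mat_inv A \<in> carrier_mat n n" "A * mat_inv A = 1\<^sub>m n" "mat_inv A * A = 1\<^sub>m n"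
proof -
  have "A \<in> Units (ring_mat TYPE('a) n ())"
    using det_non_zero_imp_unit[OF assms] .
  then obtain X where "mat_inverse A = Some X"
    using mat_inverse(1)[OF assms(1), of "()"] by (cases "mat_inverse A") auto
  then show "mat_inv A \<in> carrier_mat n n" "A * mat_inv A = 1\<^sub>m n" "mat_inv A * A = 1\<^sub>m n"
    using mat_inverse(2)[OF assms(1)] by (auto simp: mat_inv_def)
qed

lemma mat_inv_eqI:
  assumes A: "A \<in> carrier_mat n n" and X: "X \<in> carrier_mat n n" and "A * X = 1\<^sub>m n"
  shows "mat_inv A = X"
proof -
  have "det A * det X = 1"
    using det_mult[OF A X] assms(3) by simp
  then have "det A \<noteq> 0"
    by auto
  note inv = mat_inv[OF A this]
  have "mat_inv A = mat_inv A * (A * X)"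
    using inv assms(3) by simp
  also have "\<dots> = X"
    using inv A X by (simp flip: assoc_mult_mat)
  finally show ?thesis .
qed

text \<open>Multiply \<open>T * M = M' * T\<close> by the inverse of \<open>M'\<close> on the left
  and that of \<open>M\<close> on the right. \<open>T\<close> is rectangular, since it will map a
  state space onto a smaller one.\<close>

lemma mat_inv_intertwine:
  assumes M: "M \<in> carrier_mat n n" "det M \<noteq> 0" and M': "M' \<in> carrier_mat r r" "det M' \<noteq> 0"
    and T: "T \<in> carrier_mat r n" and comm: "T * M = M' * T"
  shows "T * mat_inv M = mat_inv M' * T"
proof -
  note i = mat_inv[OF M] and i' = mat_inv[OF M']
  have Ti: "T * mat_inv M \<in> carrier_mat r n"
    using T i(1) by (rule mult_carrier_mat)
  have "T * mat_inv M = mat_inv M' * M' * (T * mat_inv M)"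
    using i'(3) left_mult_one_mat[OF Ti] by simp
  also have "\<dots> = mat_inv M' * (M' * T * mat_inv M)"
    using assoc_mult_mat[OF i'(1) M'(1) Ti] assoc_mult_mat[OF M'(1) T i(1)] by simp
  also have "M' * T * mat_inv M = T"
    using i i' T M by (simp flip: comm add: assoc_mult_mat[of _ r n _ n _ n])
  finally show ?thesis .
qed

section \<open>The resolvent as a polynomial numerator over the characteristic polynomial\<close>

text \<open>Up to sign, each entry is a minor of size n - 1, and each of its rows contributes at
  most one degree.\<close>

lemma degree_adj_mat_le:
  assumes "A \<in> carrier_mat n n" and "\<And>i j. i < n \<Longrightarrow> j < n \<Longrightarrow> degree (A $$ (i, j)) \<le> 1"
    and "i < n" "j < n"
  shows "degree (adj_mat A $$ (i, j)) \<le> n - 1"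
proof -
  have "degree (det (mat_delete A j i)) \<le> 1 * (n - 1)"
  proof (rule degree_det_le)
    show "mat_delete A j i \<in> carrier_mat (n - 1) (n - 1)"
      using assms(1) by (rule mat_delete_carrier)
  qed (use assms in \<open>auto simp: mat_delete_def\<close>)
  moreover have "degree ((- 1) ^ l * q) = degree q" for l and q :: "'a poly"
    by (cases "even l") auto
  ultimately show ?thesis
    using assms by (simp add: adj_mat_def cofactor_def)
qed

abbreviation const_mat :: "'a :: zero mat \<Rightarrow> 'a poly mat" where
  "const_mat \<equiv> map_mat (\<lambda>a. [:a:])"

text \<open>This is the q_v of the overview. By Cramer's rule the adjugate equals p(x) times the
  inverse of xI - A, so the product is a polynomial from the start and no rational functions are
  needed.\<close>

definition resolvent_numerator :: "'a :: comm_ring_1 mat \<Rightarrow> 'a mat \<Rightarrow> 'a mat \<Rightarrow> 'a poly" where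
  "resolvent_numerator A C v = (const_mat C * (adj_mat (char_poly_matrix A) * const_mat v)) $$ (0, 0)"

lemma const_mat_mult:
  fixes A :: "'a :: comm_ring_1 mat"
  assumes "A \<in> carrier_mat l n" "B \<in> carrier_mat n r"
  shows "const_mat (A * B) = const_mat A * const_mat B"
proof -
  interpret semiring_hom "\<lambda>a :: 'a. [:a:]"
    by unfold_locales (auto simp: one_pCons)
  show ?thesis
    using assms by (rule mat_hom_mult)
qed

lemma degree_resolvent_numerator_le:
  fixes A :: "'a :: idom mat"
  assumes A: "A \<in> carrier_mat n n" and C: "C \<in> carrier_mat 1 n" and v: "v \<in> carrier_mat n 1"
  shows "degree (resolvent_numerator A C v) \<le> n - 1"
proof -
  note adj = adj_mat(1)[OF char_poly_matrix_closed[OF A]]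
  have "degree (adj_mat (char_poly_matrix A) $$ (i, j)) \<le> n - 1" if "i < n" "j < n" for i j
    using char_poly_matrix_closed[OF A] _ that
    by (rule degree_adj_mat_le) (use A in \<open>auto simp: char_poly_matrix_def one_mat_def\<close>)
  then show ?thesis
    unfolding resolvent_numerator_def using A C v adj
    by (auto simp: scalar_prod_def smult_sum2 intro!: degree_sum_le degree_smult_le[THEN order_trans])
qed

lemma mat_add_minus_cancel:
  fixes A :: "'a :: ab_group_add mat"
  assumes "A \<in> carrier_mat nr nc" "B \<in> carrier_mat nr nc"
  shows "A + (B - A) = B"
  by (rule eq_matI) (use assms in auto)

text \<open>Obtained by multiplying \<open>adj(xI - A) (xI - A) = det(xI - A) I\<close> by \<open>C\<close> from the left and \<open>v\<close> from
  the right.\<close>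

lemma pCons_resolvent_numerator:
  fixes A :: "'a :: idom mat"
  assumes A: "A \<in> carrier_mat n n" and C: "C \<in> carrier_mat 1 n" and v: "v \<in> carrier_mat n 1"
  shows "pCons 0 (resolvent_numerator A C v) =
    resolvent_numerator A C (A * v) + Polynomial.smult ((C * v) $$ (0, 0)) (char_poly A)"
proof -
  let ?M = "char_poly_matrix A" and ?Pv = "const_mat v" and ?PC = "const_mat C"
  have M: "?M \<in> carrier_mat n n" using A by simp
  note adj = adj_mat[OF M]
  have Pv: "?Pv \<in> carrier_mat n 1" and PC: "?PC \<in> carrier_mat 1 n" using v C by auto
  have PA: "const_mat A \<in> carrier_mat n n" using A by simp
  have PAv: "const_mat A * ?Pv \<in> carrier_mat n 1" using PA Pv by simp
  have Mv: "?M * ?Pv \<in> carrier_mat n 1" using M Pv by simp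
  have "char_poly_matrix A = [:0, 1:] \<cdot>\<^sub>m 1\<^sub>m n - const_mat A"
    using A by (auto simp: char_poly_matrix_def)
  then have "?M * ?Pv = [:0, 1:] \<cdot>\<^sub>m ?Pv - const_mat A * ?Pv"
    using PA Pv by (simp add: minus_mult_distrib_mat[of _ n n] mult_smult_assoc_mat[of _ n n])
  \<comment> \<open>Writing x v as A v + (xI - A) v separates the two terms of the claim: the first
    gives the numerator for \<open>A * v\<close>, in the second the adjugate meets xI - A and leaves
    the determinant.\<close>
  then have split: "[:0, 1:] \<cdot>\<^sub>m ?Pv = const_mat A * ?Pv + ?M * ?Pv"
    using mat_add_minus_cancel[OF PAv, of "[:0, 1:] \<cdot>\<^sub>m ?Pv"] Pv by simp
  have "?PC * (adj_mat ?M * ([:0, 1:] \<cdot>\<^sub>m ?Pv)) =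
      ?PC * (adj_mat ?M * (const_mat A * ?Pv)) + ?PC * (adj_mat ?M * (?M * ?Pv))"
    unfolding split using adj(1) PAv Mv PC
    by (simp add: mult_add_distrib_mat[of _ n n _ 1] mult_add_distrib_mat[of _ 1 n _ 1])
  also have "adj_mat ?M * (?M * ?Pv) = char_poly A \<cdot>\<^sub>m ?Pv"
    using adj M Pv
    by (simp flip: assoc_mult_mat add: char_poly_def mult_smult_assoc_mat[of _ n n])
  also have "?PC * (char_poly A \<cdot>\<^sub>m ?Pv) = char_poly A \<cdot>\<^sub>m const_mat (C * v)"
    using C v PC Pv by (simp add: const_mat_mult[of _ 1 n] mult_smult_distrib[of _ 1 n])
  also have "?PC * (adj_mat ?M * ([:0, 1:] \<cdot>\<^sub>m ?Pv)) = [:0, 1:] \<cdot>\<^sub>m (?PC * (adj_mat ?M * ?Pv))"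
    using mult_smult_distrib[OF adj(1) Pv] mult_smult_distrib[OF PC mult_carrier_mat[OF adj(1) Pv]]
    by simp
  also have "const_mat A * ?Pv = const_mat (A * v)"
    using A v by (simp add: const_mat_mult[of _ n n])
  finally have "([:0, 1:] \<cdot>\<^sub>m (?PC * (adj_mat ?M * ?Pv))) $$ (0, 0) =
      (?PC * (adj_mat ?M * const_mat (A * v)) + char_poly A \<cdot>\<^sub>m const_mat (C * v)) $$ (0, 0)"
    by simp
  then show ?thesis
    using A C v adj(1) by (simp add: resolvent_numerator_def del: index_mult_mat(1))
qed

text \<open>The numbers C A^j v are the coefficients of x^(-j-1) in the expansion of q_v / p at
  infinity, so the leading ones vanish according to the degree gap. The induction replaces v by A v,
  which shifts this expansion by one place.\<close>

lemma markov_zero_iff_resolvent_numerator: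
  fixes A :: "'a :: field mat"
  assumes A: "A \<in> carrier_mat n n" and C: "C \<in> carrier_mat 1 n" and v: "v \<in> carrier_mat n 1"
    and "n > 0"
  shows "(\<forall>j<l. (C * (A ^\<^sub>m j * v)) $$ (0, 0) = 0) \<longleftrightarrow>
    resolvent_numerator A C v = 0 \<or> degree (resolvent_numerator A C v) + l < n"
  using v
proof (induction l arbitrary: v)
  case 0
  then show ?case
    using degree_resolvent_numerator_le[OF A C 0] \<open>n > 0\<close> by auto
next
  case (Suc l)
  let ?q = "resolvent_numerator A C v" and ?q' = "resolvent_numerator A C (A * v)"
  let ?h = "(C * v) $$ (0, 0)"
  have Av: "A * v \<in> carrier_mat n 1"
    using A Suc.prems by simp
  have pow: "A ^\<^sub>m Suc j * v = A ^\<^sub>m j * (A * v)" for j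
    using A Suc.prems by (simp add: assoc_mult_mat[of _ n n _ n _ 1])
  have "(\<forall>j<Suc l. (C * (A ^\<^sub>m j * v)) $$ (0, 0) = 0) \<longleftrightarrow>
      ?h = 0 \<and> (\<forall>j<l. (C * (A ^\<^sub>m j * (A * v))) $$ (0, 0) = 0)"
    unfolding All_less_Suc2 pow using A Suc.prems by simp
  also have "\<dots> \<longleftrightarrow> ?h = 0 \<and> (?q' = 0 \<or> degree ?q' + l < n)"
    using Suc.IH[OF Av] by simp
  also have "\<dots> \<longleftrightarrow> ?q = 0 \<or> degree ?q + Suc l < n"
  proof -
    have step: "pCons 0 ?q = ?q' + Polynomial.smult ?h (char_poly A)"
      by (rule pCons_resolvent_numerator[OF A C Suc.prems])
    have "?q' = 0 \<or> degree ?q' + 0 < n"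
      using degree_resolvent_numerator_le[OF A C Av] \<open>n > 0\<close> by auto
    then have q': "degree ?q' < n"
      using \<open>n > 0\<close> by auto
    have p: "degree (char_poly A) = n" "coeff (char_poly A) n = 1"
      using degree_monic_char_poly[OF A] by auto
    \<comment> \<open>The characteristic polynomial is monic of degree n and \<open>?q'\<close> has
      smaller degree, so C v is the coefficient of x^n in x q_v.\<close>
    have lead: "coeff (pCons 0 ?q) n = ?h"
      using q' p by (simp add: step coeff_eq_0)
    show ?thesis
    proof (cases "?h = 0")
      case True
      then show ?thesis
        using step by (metis add_Suc_right add_Suc degree_pCons_eq_if add_0_right pCons_eq_0_iff smult_0_left)
    next
      \<comment> \<open>A nonzero coefficient at x^n forces degree at least n - 1 on
        \<open>?q\<close>, so both sides are false.\<close>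
      case False
      then have "?q \<noteq> 0" "n \<le> degree (pCons 0 ?q)"
        using lead by (auto intro: le_degree simp del: degree_pCons_eq_if)
      then show ?thesis
        using False by (auto simp: degree_pCons_eq_if)
    qed
  qed
  finally show ?case .
qed

text \<open>Evaluation at s is a ring homomorphism, so it carries the adjugate identity over to M;
  dividing by M turns the evaluated adjugate into p(s) times the inverse.\<close>

lemma poly_resolvent_numerator:
  fixes A :: "'a :: field mat"
  assumes A: "A \<in> carrier_mat n n" and C: "C \<in> carrier_mat 1 n" and v: "v \<in> carrier_mat n 1"
    and M: "M = s \<cdot>\<^sub>m 1\<^sub>m n - A" and nz: "poly (char_poly A) s \<noteq> 0"
  shows "poly (resolvent_numerator A C v) s = poly (char_poly A) s * (C * mat_inv M * v) $$ (0, 0)"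
proof -
  let ?M = "char_poly_matrix A" and ?E = "map_mat (\<lambda>f :: 'a poly. poly f s)"
  have Mc: "?M \<in> carrier_mat n n" using A by simp
  note adj = adj_mat[OF Mc]
  have Ea: "?E (adj_mat ?M) \<in> carrier_mat n n" using adj by simp
  have EM: "?E ?M = M"
    by (rule eq_matI) (use A in \<open>auto simp: M char_poly_matrix_def one_mat_def\<close>)
  have E: "?E (const_mat X) = X" for X
    by (rule eq_matI) auto
  have detM: "det M = poly (char_poly A) s"
    by (simp add: char_poly_def flip: EM comm_ring_hom.hom_det[OF poly_hom.comm_ring_hom_axioms])
  have MM: "M \<in> carrier_mat n n" using A M by auto
  note inv = mat_inv[OF MM, unfolded detM, OF nz]
  have "?E (?M * adj_mat ?M) = ?E (char_poly A \<cdot>\<^sub>m 1\<^sub>m n)"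
    using adj by (simp add: char_poly_def)
  also have "?E (?M * adj_mat ?M) = M * ?E (adj_mat ?M)"
    using semiring_hom.mat_hom_mult[OF poly_hom.semiring_hom_axioms, OF Mc adj(1)] EM by simp
  also have "?E (char_poly A \<cdot>\<^sub>m 1\<^sub>m n) = poly (char_poly A) s \<cdot>\<^sub>m 1\<^sub>m n"
    by (rule eq_matI) (auto simp: one_mat_def)
  finally have MEa: "M * ?E (adj_mat ?M) = poly (char_poly A) s \<cdot>\<^sub>m 1\<^sub>m n" .
  have "?E (adj_mat ?M) = mat_inv M * M * ?E (adj_mat ?M)"
    using inv Ea by simp
  also have "\<dots> = mat_inv M * (poly (char_poly A) s \<cdot>\<^sub>m 1\<^sub>m n)"
    using assoc_mult_mat[OF inv(1) MM Ea] MEa by simp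
  also have "\<dots> = poly (char_poly A) s \<cdot>\<^sub>m mat_inv M"
    using inv(1) mult_smult_distrib[OF inv(1) one_carrier_mat, of "poly (char_poly A) s"] by simp
  finally have Eadj: "?E (adj_mat ?M) = poly (char_poly A) s \<cdot>\<^sub>m mat_inv M" .
  have cv: "const_mat v \<in> carrier_mat n 1" and cC: "const_mat C \<in> carrier_mat 1 n"
    using v C by auto
  have av: "adj_mat ?M * const_mat v \<in> carrier_mat n 1"
    using adj(1) cv by (rule mult_carrier_mat)
  have iv: "mat_inv M * v \<in> carrier_mat n 1"
    using inv(1) v by (rule mult_carrier_mat)
  have "?E (const_mat C * (adj_mat ?M * const_mat v)) = C * (?E (adj_mat ?M) * v)"
    using semiring_hom.mat_hom_mult[OF poly_hom.semiring_hom_axioms, OF cC av]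
      semiring_hom.mat_hom_mult[OF poly_hom.semiring_hom_axioms, OF adj(1) cv]
    by (simp add: E)
  also have "\<dots> = C * (poly (char_poly A) s \<cdot>\<^sub>m (mat_inv M * v))"
    using inv v by (simp add: Eadj mult_smult_assoc_mat[of _ n n])
  also have "\<dots> = poly (char_poly A) s \<cdot>\<^sub>m (C * mat_inv M * v)"
    using C iv assoc_mult_mat[OF C inv(1) v] by (simp add: mult_smult_distrib[of _ 1 n])
  finally have "?E (const_mat C * (adj_mat ?M * const_mat v)) $$ (0, 0) =
      (poly (char_poly A) s \<cdot>\<^sub>m (C * mat_inv M * v)) $$ (0, 0)"
    by simp
  then show ?thesis
    using C v by (simp add: resolvent_numerator_def del: index_mult_mat(1))
qed

section \<open>Intertwined state spaces, and observability of minimal realizations\<close>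

lemma cmat_mult:
  "A \<in> carrier_mat l n \<Longrightarrow> B \<in> carrier_mat n r \<Longrightarrow> cmat (A * B) = cmat A * cmat B"
  by (rule of_real_hom.mat_hom_mult)

lemma sI_minus_carrier: "A \<in> carrier_mat n n \<Longrightarrow> sI_minus s A \<in> carrier_mat n n"
  by (simp add: sI_minus_def minus_carrier_mat)

lemma det_sI_minus:
  assumes "A \<in> carrier_mat n n"
  shows "det (sI_minus s A) = poly (char_poly (cmat A)) s"
proof -
  have "map_mat (\<lambda>f. poly f s) (char_poly_matrix (cmat A)) = sI_minus s A"
    by (rule eq_matI) (use assms in \<open>auto simp: sI_minus_def char_poly_matrix_def one_mat_def\<close>)
  then show ?thesis
    by (simp add: char_poly_def flip: comm_ring_hom.hom_det[OF poly_hom.comm_ring_hom_axioms])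
qed

lemma C_resolvent_carrier:
  assumes "A \<in> carrier_mat n n" "C \<in> carrier_mat 1 n" "det (sI_minus s A) \<noteq> 0"
  shows "C_resolvent C A s \<in> carrier_mat 1 n"
  unfolding C_resolvent_def using assms mat_inv(1)[OF sI_minus_carrier] by (intro mult_carrier_mat) auto

text \<open>If \<open>T\<close> intertwines the two state spaces, then the first system maps onto the second one with
  the same output, so that both have the same transfer function.\<close>

lemma C_resolvent_intertwine:
  assumes A: "A \<in> carrier_mat n n" and B: "B \<in> carrier_mat n 1" and T: "T \<in> carrier_mat r n"
    and A': "A' \<in> carrier_mat r r" and C': "C' \<in> carrier_mat 1 r"
    and TA: "T * A = A' * T"
    and nz: "det (sI_minus s A) \<noteq> 0" "det (sI_minus s A') \<noteq> 0"
  shows "C_resolvent C' A' s * cmat (T * B) = C_resolvent (C' * T) A s * cmat B"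
proof -
  have cT: "cmat T \<in> carrier_mat r n" and cA: "cmat A \<in> carrier_mat n n"
    and cA': "cmat A' \<in> carrier_mat r r" and cB: "cmat B \<in> carrier_mat n 1"
    and cC': "cmat C' \<in> carrier_mat 1 r"
    using assms by auto
  have "cmat T * cmat A = cmat A' * cmat T"
    using TA cmat_mult[OF T A] cmat_mult[OF A' T] by simp
  then have "cmat T * sI_minus s A = sI_minus s A' * cmat T"
    using A A' cT cA cA' mult_minus_distrib_mat[OF cT _ cA, of "s \<cdot>\<^sub>m 1\<^sub>m n"]
      minus_mult_distrib_mat[OF _ cA' cT, of "s \<cdot>\<^sub>m 1\<^sub>m r"]
      mult_smult_distrib[OF cT one_carrier_mat, of s] mult_smult_assoc_mat[OF one_carrier_mat cT, of s]
    by (simp add: sI_minus_def)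
  then have comm: "cmat T * mat_inv (sI_minus s A) = mat_inv (sI_minus s A') * cmat T"
    using mat_inv_intertwine[OF sI_minus_carrier[OF A] nz(1) sI_minus_carrier[OF A'] nz(2) cT] by simp
  note i = mat_inv(1)[OF sI_minus_carrier[OF A] nz(1)]
  note i' = mat_inv(1)[OF sI_minus_carrier[OF A'] nz(2)]
  have "C_resolvent C' A' s * cmat (T * B) = cmat C' * (mat_inv (sI_minus s A') * cmat T) * cmat B"
    using cT cC' i' cB
    by (simp add: C_resolvent_def cmat_mult[OF T B]
        assoc_mult_mat[of _ 1 r _ r _ 1] assoc_mult_mat[of _ r r _ n _ 1]
        assoc_mult_mat[of _ 1 r _ n _ 1])
  also have "\<dots> = C_resolvent (C' * T) A s * cmat B"
    using cT cC' i
    by (simp add: C_resolvent_def cmat_mult[OF C' T] flip: comm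
        add: assoc_mult_mat[of _ 1 r _ n _ n])
  finally show ?thesis .
qed

text \<open>The old realization is constrained only where det(sI - A) is nonzero, whereas the new
  one is tested wherever det(sI - A') is. The last premise closes this gap: away from the zeros of
  \<open>den\<close> the old resolvent exists too.\<close>

lemma realization_intertwine:
  assumes r: "realization n A B C D num den" and T: "T \<in> carrier_mat r n"
    and A': "A' \<in> carrier_mat r r" and C': "C' \<in> carrier_mat 1 r"
    and "T * A = A' * T" "C = C' * T"
    and den: "\<And>s. poly den s \<noteq> 0 \<Longrightarrow> det (sI_minus s A) \<noteq> 0"
  shows "realization r A' (T * B) C' D num den"
proof -
  have "siso_system n A B C" 
    using r by (simp add: realization_def)
  then have AB: "A \<in> carrier_mat n n" "B \<in> carrier_mat n 1"
    by (auto simp: siso_system_def)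
  show ?thesis
    using r den assms(5,6) C_resolvent_intertwine[OF AB T A' C' assms(5)] AB T A' C'
    by (auto simp: realization_def siso_system_def transfer_function_def)
qed

text \<open>If \<open>v \<noteq> 0\<close> is unobservable, the rows \<open>C A\<^sup>i\<close> with \<open>i < n\<close> are linearly dependent. For \<open>r\<close> the last
  index in a linear relation, \<open>C A\<^sup>r\<close> is a combination of the earlier rows, and the companion matrix of
  that relation gives a realization of dimension \<open>r < n\<close>.\<close>

lemma minimal_realization_observable:
  assumes min: "minimal_realization n A B C D num den"
    and den: "\<And>s. poly den s \<noteq> 0 \<Longrightarrow> det (sI_minus s A) \<noteq> 0"
    and v: "v \<in> carrier_mat n 1" and Av: "\<And>j. (C * (A ^\<^sub>m j * v)) $$ (0, 0) = 0"
  shows "v = 0\<^sub>m n 1"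
proof (rule ccontr)
  assume "v \<noteq> 0\<^sub>m n 1"
  have real: "realization n A B C D num den"
    and min: "\<And>r A' B' C' D'. realization r A' B' C' D' num den \<Longrightarrow> n \<le> r"
    using min unfolding minimal_realization_def by blast+
  then have A: "A \<in> carrier_mat n n" and C: "C \<in> carrier_mat 1 n"
    by (auto simp: realization_def siso_system_def)
  define R where "R i = row (C * A ^\<^sub>m i) 0" for i
  have R: "R i \<in> carrier_vec n" for i
    unfolding R_def using A C by (intro row_carrier_vec[of _ 1] mult_carrier_mat[of _ 1 n]) auto
  define Ob where "Ob = mat n n (\<lambda>(i, j). R i $ j)"
  have Ob: "Ob \<in> carrier_mat n n"
    by (simp add: Ob_def)
  have "Ob *\<^sub>v col v 0 = 0\<^sub>v n"
  proof (rule eq_vecI)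
    fix i assume i: "i < dim_vec (0\<^sub>v n :: real vec)"
    then have "(Ob *\<^sub>v col v 0) $ i = R i \<bullet> col v 0"
      using R[of i] v by (simp add: Ob_def scalar_prod_def)
    also have "\<dots> = (C * A ^\<^sub>m i * v) $$ (0, 0)"
      using C v by (simp add: R_def)
    also have "\<dots> = 0"
      using Av[of i] A C v by (simp add: assoc_mult_mat[of _ 1 n _ n _ 1])
    finally show "(Ob *\<^sub>v col v 0) $ i = 0\<^sub>v n $ i"
      using i by simp
  qed (simp add: Ob_def)
  moreover have "col v 0 \<noteq> 0\<^sub>v n"
  proof
    assume 0: "col v 0 = 0\<^sub>v n"
    have "v $$ (i, 0) = 0" if "i < n" for i
      using arg_cong[OF 0, of "\<lambda>x. x $ i"] that v by simp
    then have "v = 0\<^sub>m n 1"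
      using v by (intro eq_matI) auto
    with \<open>v \<noteq> 0\<^sub>m n 1\<close> show False ..
  qed
  ultimately have "det Ob = 0"
    using det_0_iff_vec_prod_zero[OF Ob] v by (auto intro!: exI[of _ "col v 0"])
  \<comment> \<open>The vector v only gives a relation between columns of the observability matrix;
    transposing yields coefficients w of a relation between its rows C A^i.\<close>
  then have "det Ob\<^sup>T = 0"
    using det_transpose[OF Ob] by simp
  then obtain w where w: "w \<in> carrier_vec n" "w \<noteq> 0\<^sub>v n" and Obw: "Ob\<^sup>T *\<^sub>v w = 0\<^sub>v n"
    using det_0_iff_vec_prod_zero[of "Ob\<^sup>T" n] Ob by auto
  have comb: "(\<Sum>i<n. w $ i * R i $ l) = 0" if "l < n" for l
    using arg_cong[OF Obw, of "\<lambda>x. x $ l"] that w(1)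
    by (simp add: Ob_def scalar_prod_def mult.commute atLeast0LessThan)
  define r where "r = Max {i. i < n \<and> w $ i \<noteq> 0}"
  have "{i. i < n \<and> w $ i \<noteq> 0} \<noteq> {}"
    using w by (auto intro!: eq_vecI)
  then have "r \<in> {i. i < n \<and> w $ i \<noteq> 0}"
    unfolding r_def by (intro Max_in) auto
  then have r: "r < n" "w $ r \<noteq> 0"
    by auto
  have above: "w $ i = 0" if "r < i" "i < n" for i
    using Max_ge[of "{i. i < n \<and> w $ i \<noteq> 0}" i] that unfolding r_def by fastforce
  define a where "a i = - w $ i / w $ r" for i
  have last: "R r $ l = (\<Sum>i<r. a i * R i $ l)" if "l < n" for l
  proof -
    have "(\<Sum>i<n. w $ i * R i $ l) = (\<Sum>i<Suc r. w $ i * R i $ l)"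
      using r above by (intro sum.mono_neutral_right) auto
    then have "w $ r * R r $ l = - (\<Sum>i<r. w $ i * R i $ l)"
      using comb[OF that] by simp
    then have "R r $ l = - (\<Sum>i<r. w $ i * R i $ l) / w $ r"
      using r by (simp add: field_simps)
    also have "\<dots> = (\<Sum>i<r. a i * R i $ l)"
      by (simp add: a_def sum_divide_distrib sum_negf)
    finally show ?thesis .
  qed
  \<comment> \<open>The new state coordinates of x are the numbers C A^i x for i < r. Applying A
    shifts them, the relation \<open>last\<close> supplies the final one, and the output is
    coordinate 0.\<close>
  define T where "T = mat r n (\<lambda>(i, j). R i $ j)"
  define A' where "A' = mat r r (\<lambda>(i, j). if Suc i < r then if j = Suc i then 1 else 0 else a j)"
  define C' where "C' = mat 1 r (\<lambda>(i, j). if j = 0 then 1 else 0 :: real)"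
  have "T * A = A' * T"
  proof (rule eq_matI)
    fix i j assume "i < dim_row (A' * T)" "j < dim_col (A' * T)"
    then have i: "i < r" and j: "j < n"
      by (auto simp: A'_def T_def)
    have "(T * A) $$ (i, j) = R i \<bullet> col A j"
      using i j A R[of i] by (simp add: T_def scalar_prod_def)
    also have "\<dots> = (C * A ^\<^sub>m i * A) $$ (0, j)"
      using A C j by (simp add: R_def)
    also have "\<dots> = R (Suc i) $ j"
      using A C j by (simp add: R_def assoc_mult_mat[of _ 1 n _ n _ n] del: index_mult_mat(1))
    also have "\<dots> = (\<Sum>l<r. A' $$ (i, l) * R l $ j)"
    proof (cases "Suc i < r")
      case True
      then have "(\<Sum>l<r. A' $$ (i, l) * R l $ j) = (\<Sum>l<r. if l = Suc i then R l $ j else 0)"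
        using i by (intro sum.cong) (auto simp: A'_def)
      with True show ?thesis
        by simp
    next
      case False
      with i have "r = Suc i"
        by simp
      then show ?thesis
        using last[OF j] by (simp add: A'_def)
    qed
    also have "\<dots> = (A' * T) $$ (i, j)"
      using i j by (simp add: A'_def T_def scalar_prod_def atLeast0LessThan)
    finally show "(T * A) $$ (i, j) = (A' * T) $$ (i, j)" .
  qed (use A in \<open>auto simp: A'_def T_def\<close>)
  moreover have "C = C' * T"
  proof (rule eq_matI)
    fix i j assume "i < dim_row (C' * T)" "j < dim_col (C' * T)"
    then have i: "i = 0" and j: "j < n"
      by (auto simp: C'_def T_def)
    have "(C' * T) $$ (0, j) = (\<Sum>l<r. (if l = 0 then 1 else 0) * R l $ j)"
      using j by (simp add: C'_def T_def scalar_prod_def atLeast0LessThan)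
    also have "\<dots> = (\<Sum>l<r. if l = 0 then R 0 $ j else 0)"
      by (intro sum.cong) auto
    also have "\<dots> = R 0 $ j"
      \<comment> \<open>For r = 0 the sum is empty, but then \<open>last\<close> says that C itself
        is zero, so dimension 0 is a legitimate case.\<close>
      using last[OF j] by (cases "r = 0") auto
    also have "\<dots> = C $$ (0, j)"
      using A C j by (simp add: R_def)
    finally show "C $$ (i, j) = (C' * T) $$ (i, j)"
      using i by simp
  qed (use C in \<open>auto simp: C'_def T_def\<close>)
  ultimately have "realization r A' (T * B) C' D num den"
    using real den by (intro realization_intertwine[where A = A and C = C and n = n])
      (auto simp: A'_def C'_def T_def)
  then have "n \<le> r"
    by (rule min)
  with r show False
    by simp
qed

section \<open>The two linear systems as scalar equations\<close>

lemma single_column_eq_iff: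
  assumes "X \<in> carrier_mat m 1" "Y \<in> carrier_mat m 1"
  shows "X = Y \<longleftrightarrow> (\<forall>i<m. X $$ (i, 0) = Y $$ (i, 0))"
proof (intro iffI allI impI)
  assume eq: "\<forall>i<m. X $$ (i, 0) = Y $$ (i, 0)"
  show "X = Y"
    by (rule eq_matI) (use assms eq in \<open>simp_all add: less_Suc0\<close>)
qed simp

lemma mat_of_rows_mult_eq_iff:
  fixes B :: "'a :: semiring_0 mat"
  assumes "B \<in> carrier_mat n 1" "set rs \<subseteq> carrier_vec n" "length xs = length rs"
  shows "mat_of_rows n rs * B = mat_of_cols (length rs) [vec_of_list xs] \<longleftrightarrow>
    map (\<lambda>r. r \<bullet> col B 0) rs = xs" (is "?L = ?R \<longleftrightarrow> _")
proof -
  have entry: "?L $$ (i, 0) = rs ! i \<bullet> col B 0" "?R $$ (i, 0) = xs ! i" if "i < length rs" for i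
  proof -
    have "rs ! i \<in> carrier_vec n"
      using assms(2) nth_mem[OF that] by blast
    then show "?L $$ (i, 0) = rs ! i \<bullet> col B 0"
      using assms(1) that by simp
    show "?R $$ (i, 0) = xs ! i"
      using that by (simp add: mat_of_cols_index vec_of_list_index)
  qed
  have "?L = ?R \<longleftrightarrow> (\<forall>i<length rs. ?L $$ (i, 0) = ?R $$ (i, 0))"
    using assms(1) by (intro single_column_eq_iff) auto
  also have "\<dots> \<longleftrightarrow> (\<forall>i<length rs. rs ! i \<bullet> col B 0 = xs ! i)"
    using entry by auto
  also have "\<dots> \<longleftrightarrow> map (\<lambda>r. r \<bullet> col B 0) rs = xs"
    using assms(3) by (simp add: list_eq_iff_nth_eq)
  finally show ?thesis .
qed

lemma markov_matrix_mult_eq_0_iff: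
  assumes A: "A \<in> carrier_mat n n" and C: "C \<in> carrier_mat 1 n" and B: "B \<in> carrier_mat n 1"
  shows "markov_matrix m A C * B = 0\<^sub>m m 1 \<longleftrightarrow> (\<forall>j<m. (C * (A ^\<^sub>m j * B)) $$ (0, 0) = 0)"
proof -
  have "(markov_matrix m A C * B) $$ (j, 0) = (C * (A ^\<^sub>m j * B)) $$ (0, 0)" if "j < m" for j
  proof -
    have "row (C * A ^\<^sub>m j) 0 \<in> carrier_vec n"
      using A C by (intro row_carrier_vec[of _ 1] mult_carrier_mat[of _ 1 n]) auto
    then have "(markov_matrix m A C * B) $$ (j, 0) = (C * A ^\<^sub>m j * B) $$ (0, 0)"
      using that A B C by (simp add: markov_matrix_def)
    then show ?thesis
      using assoc_mult_mat[OF C pow_carrier_mat[OF A] B] by simp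
  qed
  moreover have "markov_matrix m A C * B \<in> carrier_mat m 1"
    by (intro carrier_matI) (use B in \<open>simp_all add: markov_matrix_def\<close>)
  ultimately show ?thesis
    by (simp only: single_column_eq_iff[OF _ zero_carrier_mat] index_zero_mat zero_less_one
        cong: conj_cong all_cong)
qed

lemma sI_minus_0: "A \<in> carrier_mat n n \<Longrightarrow> sI_minus 0 A = - cmat A"
  by (intro eq_matI) (auto simp: sI_minus_def)

lemma det_nonzero_of_sI_minus_0:
  assumes "A \<in> carrier_mat n n" "det (sI_minus 0 A) \<noteq> 0"
  shows "det A \<noteq> 0"
  using assms det_0_negate[of "cmat A" n] by (simp add: sI_minus_0)

text \<open>At s = 0 the matrix sI - A is -A. This sign is why the right-hand side starts with 1
  although every other prescribed value is -1.\<close>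

lemma C_resolvent_0:
  assumes A: "A \<in> carrier_mat n n" and C: "C \<in> carrier_mat 1 n" and B: "B \<in> carrier_mat n 1"
    and nz: "det (sI_minus 0 A) \<noteq> 0"
  shows "(C_resolvent C A 0 * cmat B) $$ (0, 0) = - complex_of_real ((C * mat_inv A * B) $$ (0, 0))"
proof -
  note inv = mat_inv[OF A det_nonzero_of_sI_minus_0[OF A nz]]
  have "(- cmat A) * (- cmat (mat_inv A)) = cmat (A * mat_inv A)"
    using A inv(1) by (simp add: cmat_mult[OF A inv(1)])
  also have "\<dots> = 1\<^sub>m n"
    using inv by (simp add: of_real_hom.mat_hom_one)
  finally have "mat_inv (- cmat A) = - cmat (mat_inv A)"
    using A inv by (intro mat_inv_eqI) auto
  then have "C_resolvent C A 0 * cmat B = - cmat (C * mat_inv A * B)"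
    unfolding C_resolvent_def sI_minus_0[OF A] cmat_mult[OF mult_carrier_mat[OF C inv(1)] B]
      cmat_mult[OF C inv(1)]
    using B C inv(1) by (simp del: assoc_mult_mat)
  then show ?thesis
    using B C by simp
qed

lemma row_Re_Im_scalar_prod:
  assumes "G \<in> carrier_mat 1 n" "B \<in> carrier_mat n 1"
  shows "row (map_mat Re G) 0 \<bullet> col B 0 = Re ((G * cmat B) $$ (0, 0))"
    and "row (map_mat Im G) 0 \<bullet> col B 0 = Im ((G * cmat B) $$ (0, 0))"
  using assms by (auto simp: scalar_prod_def)

text \<open>B is real, so a pair of rows with real and imaginary part amounts to one complex
  equation with value -1 + 0j.\<close>

lemma interpolation_matrix_mult_eq_iff:
  assumes A: "A \<in> carrier_mat n n" and C: "C \<in> carrier_mat 1 n" and B: "B \<in> carrier_mat n 1"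
    and nz0: "det (sI_minus 0 A) \<noteq> 0"
    and nz: "\<And>i. i \<in> {1..k} \<Longrightarrow> det (sI_minus (\<i> * complex_of_real (\<omega> i)) A) \<noteq> 0"
  shows "interpolation_matrix k \<omega> A C * B = interpolation_rhs k \<longleftrightarrow>
    (C_resolvent C A 0 * cmat B) $$ (0, 0) = - 1 \<and>
    (\<forall>i\<in>{1..k}. (C_resolvent C A (\<i> * complex_of_real (\<omega> i)) * cmat B) $$ (0, 0) = - 1)"
proof -
  define G where "G i = C_resolvent C A (\<i> * complex_of_real (\<omega> i))" for i
  have G: "G i \<in> carrier_mat 1 n" if "i \<in> set [1..<k+1]" for i
    unfolding G_def using that by (intro C_resolvent_carrier A C nz) auto
  have CA: "C * mat_inv A \<in> carrier_mat 1 n"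
    using C mat_inv(1)[OF A det_nonzero_of_sI_minus_0[OF A nz0]] by (rule mult_carrier_mat)
  define rs where "rs = row (C * mat_inv A) 0 #
    concat (map (\<lambda>i. [row (map_mat Re (G i)) 0, row (map_mat Im (G i)) 0]) [1..<k+1])"
  define xs :: "real list" where "xs = 1 # concat (map (\<lambda>i. [-1, 0]) [1..<k+1])"
  have len: "length xs = length rs" "length rs = 2 * k + 1"
    by (auto simp: xs_def rs_def length_concat comp_def sum_list_triv)
  have rs: "set rs \<subseteq> carrier_vec n"
    using row_carrier_vec[OF _ CA, of 0] G by (force simp: rs_def intro!: row_carrier_vec[of _ 1])
  have "interpolation_matrix k \<omega> A C * B = interpolation_rhs k \<longleftrightarrow>
      mat_of_rows n rs * B = mat_of_cols (length rs) [vec_of_list xs]"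
    using A unfolding interpolation_matrix_def interpolation_rhs_def Let_def len(2)
    unfolding rs_def xs_def G_def by (simp only: carrier_matD)
  also have "\<dots> \<longleftrightarrow> map (\<lambda>r. r \<bullet> col B 0) rs = xs"
    using B rs len(1) by (rule mat_of_rows_mult_eq_iff)
  also have "\<dots> \<longleftrightarrow> row (C * mat_inv A) 0 \<bullet> col B 0 = 1 \<and>
      concat (map (\<lambda>i. [row (map_mat Re (G i)) 0 \<bullet> col B 0, row (map_mat Im (G i)) 0 \<bullet> col B 0]) [1..<k+1]) =
      concat (map (\<lambda>i. [-1, 0]) [1..<k+1])"
    by (simp add: rs_def xs_def map_concat comp_def)
  also have "\<dots> \<longleftrightarrow> row (C * mat_inv A) 0 \<bullet> col B 0 = 1 \<and>
      (\<forall>i\<in>set [1..<k+1]. row (map_mat Re (G i)) 0 \<bullet> col B 0 = - 1 \<and> row (map_mat Im (G i)) 0 \<bullet> col B 0 = 0)"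
    \<comment> \<open>Both lists are made of blocks of length two over the same indices, so they can
      be compared block by block.\<close>
    by (subst concat_eq_concat_iff) (auto simp: set_zip simp del: upt_Suc)
  also have "\<dots> \<longleftrightarrow> (C * mat_inv A * B) $$ (0, 0) = 1 \<and>
      (\<forall>i\<in>set [1..<k+1]. (G i * cmat B) $$ (0, 0) = - 1)"
    using row_Re_Im_scalar_prod[OF G B] C B by (simp add: complex_eq_iff del: upt_Suc)
  also have "\<dots> \<longleftrightarrow> (C_resolvent C A 0 * cmat B) $$ (0, 0) = - 1 \<and>
      (\<forall>i\<in>{1..k}. (G i * cmat B) $$ (0, 0) = - 1)"
    unfolding C_resolvent_0[OF A C B nz0] by (auto simp del: upt_Suc index_mult_mat(1))
  finally show ?thesis
    by (simp add: G_def)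
qed

section \<open>Conjugate symmetry and the count of zeros\<close>

lemma sI_minus_cnj: "sI_minus (cnj s) A = map_mat cnj (sI_minus s A)"
  if "A \<in> carrier_mat n n"
  by (rule eq_matI) (use that in \<open>auto simp: sI_minus_def one_mat_def\<close>)

lemma det_sI_minus_cnj:
  assumes "A \<in> carrier_mat n n"
  shows "det (sI_minus (cnj s) A) = cnj (det (sI_minus s A))"
proof -
  interpret cnj: comm_ring_hom cnj
    by unfold_locales auto
  show ?thesis
    by (simp add: sI_minus_cnj[OF assms])
qed

lemma C_resolvent_cnj:
  assumes A: "A \<in> carrier_mat n n" and C: "C \<in> carrier_mat 1 n" and B: "B \<in> carrier_mat n 1"
    and nz: "det (sI_minus s A) \<noteq> 0"
  shows "(C_resolvent C A (cnj s) * cmat B) $$ (0, 0) = cnj ((C_resolvent C A s * cmat B) $$ (0, 0))"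
proof -
  interpret cnj: semiring_hom cnj
    by unfold_locales auto
  have real: "map_mat cnj (cmat X) = cmat X" for X
    by (rule eq_matI) auto
  note M = sI_minus_carrier[OF A] and inv = mat_inv[OF sI_minus_carrier[OF A] nz]
  have "sI_minus (cnj s) A * map_mat cnj (mat_inv (sI_minus s A)) = 1\<^sub>m n"
    by (simp flip: cnj.mat_hom_mult[OF M inv(1)] add: sI_minus_cnj[OF A] inv(2) cnj.mat_hom_one)
  then have "mat_inv (sI_minus (cnj s) A) = map_mat cnj (mat_inv (sI_minus s A))"
    using M inv(1) by (intro mat_inv_eqI) auto
  moreover have cC: "cmat C \<in> carrier_mat 1 n" and cB: "cmat B \<in> carrier_mat n 1"
    using B C by auto
  ultimately have "C_resolvent C A (cnj s) * cmat B = map_mat cnj (C_resolvent C A s * cmat B)"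
    using cnj.mat_hom_mult[OF cC inv(1)] cnj.mat_hom_mult[OF mult_carrier_mat[OF cC inv(1)] cB]
    by (simp add: C_resolvent_def real)
  then show ?thesis
    using B C by (simp add: C_resolvent_def)
qed

lemma resolvent_numerator_complex:
  assumes A: "A \<in> carrier_mat n n" and C: "C \<in> carrier_mat 1 n" and B: "B \<in> carrier_mat n 1"
    and "poly (char_poly (cmat A)) s \<noteq> 0"
  shows "poly (resolvent_numerator (cmat A) (cmat C) (cmat B)) s =
    poly (char_poly (cmat A)) s * (C_resolvent C A s * cmat B) $$ (0, 0)"
  unfolding C_resolvent_def
proof (rule poly_resolvent_numerator[of _ n])
  show "sI_minus s A = s \<cdot>\<^sub>m 1\<^sub>m n - cmat A"
    using A by (simp add: sI_minus_def)
qed (use assms in simp_all)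

text \<open>The Markov parameters are real, but the zeros to be counted are not, so the numerator is
  taken over the complex numbers; the embedding of the reals is injective, which carries the
  equations across.\<close>

lemma markov_zero_iff_resolvent_numerator_complex:
  assumes A: "A \<in> carrier_mat n n" and C: "C \<in> carrier_mat 1 n" and B: "B \<in> carrier_mat n 1"
    and "n > 0"
  defines "q \<equiv> resolvent_numerator (cmat A) (cmat C) (cmat B)"
  shows "(\<forall>j<l. (C * (A ^\<^sub>m j * B)) $$ (0, 0) = 0) \<longleftrightarrow> q = 0 \<or> degree q + l < n"
proof -
  have h: "(cmat C * (cmat A ^\<^sub>m j * cmat B)) $$ (0, 0) = complex_of_real ((C * (A ^\<^sub>m j * B)) $$ (0, 0))"
    for j
  proof -
    have Aj: "A ^\<^sub>m j \<in> carrier_mat n n"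
      using A by simp
    have "cmat C * (cmat A ^\<^sub>m j * cmat B) = cmat (C * (A ^\<^sub>m j * B))"
      by (simp add: cmat_mult[OF C mult_carrier_mat[OF Aj B]] cmat_mult[OF Aj B]
          of_real_hom.mat_hom_pow[OF A])
    then show ?thesis
      using B C by simp
  qed
  have "(\<forall>j<l. (C * (A ^\<^sub>m j * B)) $$ (0, 0) = 0) \<longleftrightarrow>
      (\<forall>j<l. (cmat C * (cmat A ^\<^sub>m j * cmat B)) $$ (0, 0) = 0)"
    unfolding h of_real_eq_0_iff by (rule refl)
  also have "\<dots> \<longleftrightarrow> q = 0 \<or> degree q + l < n"
    unfolding q_def using A B C \<open>n > 0\<close> by (intro markov_zero_iff_resolvent_numerator) auto
  finally show ?thesis .
qed

text \<open>The sign of the imaginary part separates the points, their conjugates and 0.\<close>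

lemma card_symmetric_imaginary_points:
  fixes \<omega> :: "nat \<Rightarrow> real"
  assumes "\<forall>i\<in>{1..k}. \<omega> i > 0" "inj_on \<omega> {1..k}"
  defines "f \<equiv> \<lambda>i. \<i> * complex_of_real (\<omega> i)"
  shows "card (insert 0 (f ` {1..k} \<union> (cnj \<circ> f) ` {1..k})) = 2 * k + 1"
proof -
  have inj_f: "inj_on f {1..k}"
  proof (rule inj_onI)
    fix x y assume xy: "x \<in> {1..k}" "y \<in> {1..k}" "f x = f y"
    from xy(3) have "\<omega> x = \<omega> y"
      by (simp add: f_def)
    then show "x = y"
      using xy(1,2) by (rule inj_onD[OF assms(2)])
  qed
  have inj_cnj_f: "inj_on (cnj \<circ> f) {1..k}"
    using inj_f by (rule comp_inj_on) (rule inj_onI, simp)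
  have pos: "Im x > 0" if "x \<in> f ` {1..k}" for x
    using assms(1) that by (auto simp: f_def)
  have neg: "Im x < 0" if "x \<in> (cnj \<circ> f) ` {1..k}" for x
    using assms(1) that by (auto simp: f_def)
  have "x \<notin> (cnj \<circ> f) ` {1..k}" if "x \<in> f ` {1..k}" for x
    using pos[OF that] neg[of x] less_asym by blast
  then have "f ` {1..k} \<inter> (cnj \<circ> f) ` {1..k} = {}"
    by (rule disjoint_iff[THEN iffD2, rule_format])
  then have "card (f ` {1..k} \<union> (cnj \<circ> f) ` {1..k}) = k + k"
    by (simp only: card_Un_disjoint finite_imageI finite_atLeastAtMost card_image[OF inj_f]
        card_image[OF inj_cnj_f] card_atLeastAtMost diff_Suc_1)
  moreover have "0 \<notin> f ` {1..k} \<union> (cnj \<circ> f) ` {1..k}"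
  proof
    assume "0 \<in> f ` {1..k} \<union> (cnj \<circ> f) ` {1..k}"
    then show False
      using pos[of 0] neg[of 0] unfolding Un_iff zero_complex.sel by (metis less_irrefl)
  qed
  ultimately have "card (insert 0 (f ` {1..k} \<union> (cnj \<circ> f) ` {1..k})) = Suc (k + k)"
    by (subst card_insert_disjoint) (simp_all only: finite_Un finite_imageI finite_atLeastAtMost simp_thms)
  then show ?thesis
    by (simp only: mult_2 Suc_eq_plus1)
qed

lemma markov_zero_of_interpolation_zero:
  fixes \<omega> :: "nat \<Rightarrow> real"
  assumes A: "A \<in> carrier_mat n n" and C: "C \<in> carrier_mat 1 n" and v: "v \<in> carrier_mat n 1"
    and n: "n = 2 * k + 1 + m" and \<omega>: "\<forall>i\<in>{1..k}. \<omega> i > 0" "inj_on \<omega> {1..k}"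
    and nz0: "det (sI_minus 0 A) \<noteq> 0"
    and nz: "\<And>i. i \<in> {1..k} \<Longrightarrow> det (sI_minus (\<i> * complex_of_real (\<omega> i)) A) \<noteq> 0"
    and v0: "(C_resolvent C A 0 * cmat v) $$ (0, 0) = 0"
    and vi: "\<And>i. i \<in> {1..k} \<Longrightarrow> (C_resolvent C A (\<i> * complex_of_real (\<omega> i)) * cmat v) $$ (0, 0) = 0"
    and markov: "\<forall>j<m. (C * (A ^\<^sub>m j * v)) $$ (0, 0) = 0"
  shows "(C * (A ^\<^sub>m j * v)) $$ (0, 0) = 0"
proof -
  define q where "q = resolvent_numerator (cmat A) (cmat C) (cmat v)"
  define f where "f i = \<i> * complex_of_real (\<omega> i)" for i
  let ?Z = "insert 0 (f ` {1..k} \<union> (cnj \<circ> f) ` {1..k})"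
  note markov_iff = markov_zero_iff_resolvent_numerator_complex[OF A C v, folded q_def]
  have root: "poly q s = 0"
    if "det (sI_minus s A) \<noteq> 0" "(C_resolvent C A s * cmat v) $$ (0, 0) = 0" for s
    using resolvent_numerator_complex[OF A C v, of s] that by (simp add: q_def det_sI_minus[OF A])
  have root_cnj: "poly q (cnj s) = 0"
    if "det (sI_minus s A) \<noteq> 0" "(C_resolvent C A s * cmat v) $$ (0, 0) = 0" for s
  proof (rule root)
    have "det (sI_minus (cnj s) A) = cnj (det (sI_minus s A))"
      by (rule det_sI_minus_cnj[OF A])
    then show "det (sI_minus (cnj s) A) \<noteq> 0"
      using that by simp
    show "(C_resolvent C A (cnj s) * cmat v) $$ (0, 0) = 0"
      using C_resolvent_cnj[OF A C v that(1)] that(2) by simp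
  qed
  have zeros: "?Z \<subseteq> {s. poly q s = 0}"
    using root[OF nz0 v0] root[OF nz vi] root_cnj[OF nz vi] by (auto simp: f_def)
  have "q = 0"
  proof (rule ccontr)
    assume "q \<noteq> 0"
    then have "degree q + m < n"
      using markov_iff[of m] markov n by simp
    moreover have "2 * k + 1 \<le> degree q"
      using card_mono[OF poly_roots_finite[OF \<open>q \<noteq> 0\<close>] zeros] poly_roots_degree[OF \<open>q \<noteq> 0\<close>]
        card_symmetric_imaginary_points[OF \<omega>] by (simp add: f_def)
    ultimately show False
      using n by simp
  qed
  \<comment> \<open>For q = 0 the equivalence holds at every length, and length j + 1 includes index
    j.\<close>
  then show ?thesis
    using markov_iff[of "Suc j"] n by simp
qed

section \<open>Existence, uniqueness and the filter\<close>

lemma mult_column_minus: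
  fixes G :: "'a :: ring mat"
  assumes "G \<in> carrier_mat 1 n" "v \<in> carrier_mat n 1" "w \<in> carrier_mat n 1"
  shows "(G * (v - w)) $$ (0, 0) = (G * v) $$ (0, 0) - (G * w) $$ (0, 0)"
  using assms by (simp add: mult_minus_distrib_mat[OF assms] del: index_mult_mat(1))

theorem proposition3:
  fixes k m n n\<^sub>r :: nat
    and \<omega> :: "nat \<Rightarrow> real"
    and zr pr :: "nat \<Rightarrow> complex"
    and z p :: "complex poly"
    and A B C :: "real mat"
    and D :: real
  assumes "n\<^sub>r \<ge> 1" and "m = n\<^sub>r - 1" and "n = 2 * k + 1 + m"
    and "\<forall>i\<in>{1..k}. \<omega> i > 0" and "inj_on \<omega> {1..k}"
    and "\<forall>i\<in>{1..n}. Re (pr i) < 0"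
    and "z = [:0, 1:] * (\<Prod>i=1..k. [:(complex_of_real (\<omega> i))\<^sup>2, 0, 1:]) * (\<Prod>i=1..m. [:- zr i, 1:])"
    and "p = (\<Prod>i=1..n. [:- pr i, 1:])"
    and "minimal_realization n A B C D z p"
    and "char_poly (cmat A) = p"
    and "\<forall>i\<in>{1..k}. (C_resolvent C A (\<i> * complex_of_real (\<omega> i)) * cmat B) $$ (0, 0) = - complex_of_real D"
    and "D = 1"
    and "targets_frequencies k \<omega> (\<lambda>s. poly (p - z) s / poly p s)"
    and "relative_degree (p - z) p = int n\<^sub>r"
  shows "interpolation_matrix k \<omega> A C * B = interpolation_rhs k \<and>
         markov_matrix m A C * B = 0\<^sub>m m 1 \<and>
         (\<exists>!B'. B' \<in> carrier_mat n 1 \<and>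
                interpolation_matrix k \<omega> A C * B' = interpolation_rhs k \<and>
                markov_matrix m A C * B' = 0\<^sub>m m 1) \<and>
         realization n A B (- C) 0 (p - z) p"
proof -
  note \<omega>_pos = assms(4) and \<omega>_inj = assms(5)
  have real: "realization n A B C D z p" and D: "D = 1"
    using assms(9,12) by (auto simp: minimal_realization_def)
  then have A: "A \<in> carrier_mat n n" and B: "B \<in> carrier_mat n 1" and C: "C \<in> carrier_mat 1 n"
    by (auto simp: realization_def siso_system_def)
  have n: "n = 2 * k + 1 + m" "n > 0"
    using assms(3) by auto
  have det: "det (sI_minus s A) = poly p s" for s
    using det_sI_minus[OF A] assms(10) by simp
  have "p \<noteq> 0" and deg_p: "degree p = n"
    using degree_monic_char_poly[of "cmat A" n] A assms(10) n by auto
  \<comment> \<open>The closed half-plane is used because the interpolation points lie on its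
    boundary.\<close>
  have p_nz: "poly p s \<noteq> 0" if "Re s \<ge> 0" for s
  proof -
    have "s \<noteq> pr i" if "i \<in> {1..n}" for i
      using assms(6) that \<open>Re s \<ge> 0\<close> by force
    then show ?thesis
      by (simp add: assms(8) poly_prod)
  qed
  have nz0: "det (sI_minus 0 A) \<noteq> 0"
    and nz: "det (sI_minus (\<i> * complex_of_real (\<omega> i)) A) \<noteq> 0" for i
    using p_nz by (simp_all add: det)
  define G where "G s B' = (C_resolvent C A s * cmat B') $$ (0, 0)" for s B'
  have G: "G s B = poly z s / poly p s - 1" if "poly p s \<noteq> 0" for s
    using real that by (simp add: realization_def transfer_function_def G_def D det algebra_simps)
  define q where "q = resolvent_numerator (cmat A) (cmat C) (cmat B)"
  \<comment> \<open>The transfer function gives q = z - p only away from the roots of p; the extra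
    factor p makes the identity hold everywhere and is cancelled afterwards.\<close>
  have "poly ((q - (z - p)) * p) s = 0" for s
  proof (cases "poly p s = 0")
    case False
    have "poly q s = poly p s * G s B"
      using resolvent_numerator_complex[OF A C B, of s] False assms(10)
      by (simp add: q_def G_def)
    then show ?thesis
      using False by (simp add: G field_simps)
  qed simp
  then have "(q - (z - p)) * p = 0"
    using poly_all_0_iff_0 by blast
  with \<open>p \<noteq> 0\<close> have q: "q = z - p"
    by simp
  \<comment> \<open>The relative degree gives p - z the degree n - \<open>n\<^sub>r\<close>, which
    is n - m - 1.\<close>
  have "degree q + m < n"
    using assms(1,2,14) deg_p degree_minus[of "p - z"] by (simp add: q relative_degree_def)
  then have markov_B: "\<forall>j<m. (C * (A ^\<^sub>m j * B)) $$ (0, 0) = 0"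
    using markov_zero_iff_resolvent_numerator_complex[OF A C B n(2), of m]
    unfolding q_def by blast
  \<comment> \<open>The value at 0 comes from the factor s of z, the values at j omega_i from the
    assumption on the resolvent with D = 1.\<close>
  have "poly z 0 = 0"
    by (simp add: assms(7))
  then have G_B: "G 0 B = - 1" "\<forall>i\<in>{1..k}. G (\<i> * complex_of_real (\<omega> i)) B = - 1"
    using G[of 0] p_nz[of 0] assms(11) D by (simp_all add: G_def)
  have iff: "interpolation_matrix k \<omega> A C * B' = interpolation_rhs k \<longleftrightarrow>
      G 0 B' = - 1 \<and> (\<forall>i\<in>{1..k}. G (\<i> * complex_of_real (\<omega> i)) B' = - 1)"
    if "B' \<in> carrier_mat n 1" for B'
    unfolding G_def using A C that nz0 nz by (rule interpolation_matrix_mult_eq_iff)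
  have sol: "interpolation_matrix k \<omega> A C * B = interpolation_rhs k"
      "markov_matrix m A C * B = 0\<^sub>m m 1"
    using iff[OF B] G_B markov_matrix_mult_eq_0_iff[OF A C B] markov_B by simp_all
  have unique: "B' = B"
    if B': "B' \<in> carrier_mat n 1" "interpolation_matrix k \<omega> A C * B' = interpolation_rhs k"
      "markov_matrix m A C * B' = 0\<^sub>m m 1" for B'
  proof -
    let ?v = "B' - B"
    have v: "?v \<in> carrier_mat n 1"
      using B by (rule minus_carrier_mat)
    have G_v: "G s ?v = G s B' - G s B" if "det (sI_minus s A) \<noteq> 0" for s
    proof -
      have "cmat ?v = cmat B' - cmat B"
        using B B' by (intro eq_matI) auto
      then show ?thesis
        using mult_column_minus[OF C_resolvent_carrier[OF A C that], of "cmat B'" "cmat B"] B B'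
        by (simp add: G_def del: index_mult_mat(1))
    qed
    have G_B': "G 0 B' = - 1" "\<forall>i\<in>{1..k}. G (\<i> * complex_of_real (\<omega> i)) B' = - 1"
      using iff[OF B'(1)] B'(2) by auto
    have markov_v: "(C * (A ^\<^sub>m j * ?v)) $$ (0, 0) = 0" if "j < m" for j
    proof -
      have Aj: "A ^\<^sub>m j \<in> carrier_mat n n"
        using A by simp
      have "(C * (A ^\<^sub>m j * ?v)) $$ (0, 0) =
          (C * (A ^\<^sub>m j * B')) $$ (0, 0) - (C * (A ^\<^sub>m j * B)) $$ (0, 0)"
        unfolding mult_minus_distrib_mat[OF Aj B'(1) B]
        by (rule mult_column_minus[OF C mult_carrier_mat[OF Aj B'(1)] mult_carrier_mat[OF Aj B]])
      then show ?thesis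
        using markov_B markov_matrix_mult_eq_0_iff[OF A C B'(1), of m] B'(3) that by simp
    qed
    have "(C * (A ^\<^sub>m j * ?v)) $$ (0, 0) = 0" for j
    proof (rule markov_zero_of_interpolation_zero[OF A C v n(1) \<omega>_pos \<omega>_inj nz0 nz])
      show "(C_resolvent C A 0 * cmat ?v) $$ (0, 0) = 0"
        using G_v[OF nz0] G_B(1) G_B'(1) by (simp add: G_def)
      show "(C_resolvent C A (\<i> * complex_of_real (\<omega> i)) * cmat ?v) $$ (0, 0) = 0"
        if "i \<in> {1..k}" for i
        using G_v[OF nz[of i]] bspec[OF G_B(2) that] bspec[OF G_B'(2) that] by (simp add: G_def)
    qed (use markov_v in blast)
    then have "?v = 0\<^sub>m n 1"
      by (intro minimal_realization_observable[OF assms(9) _ v]) (simp_all add: det)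
    have "B' = B + ?v"
      using mat_add_minus_cancel[OF B B'(1)] by simp
    with \<open>?v = 0\<^sub>m n 1\<close> show ?thesis
      using B by simp
  qed
  \<comment> \<open>In 1 - z/p the feedthrough D = 1 cancels, leaving -C (sI - A)^-1 B.\<close>
  have "realization n A B (- C) 0 (p - z) p"
    unfolding realization_def
  proof (intro conjI allI impI)
    show "siso_system n A B (- C)"
      using A B C by (simp add: siso_system_def)
    fix s assume s: "det (sI_minus s A) \<noteq> 0 \<and> poly p s \<noteq> 0"
    have "cmat (- C) = - cmat C"
      by (rule eq_matI) auto
    then have "C_resolvent (- C) A s = - C_resolvent C A s"
      using mat_inv(1)[OF sI_minus_carrier[OF A], of s] C s by (simp add: C_resolvent_def)
    then have "transfer_function A B (- C) 0 s = - G s B"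
      using C_resolvent_carrier[OF A C, of s] B s
      by (simp add: transfer_function_def G_def del: index_mult_mat(1))
    also have "\<dots> = poly (p - z) s / poly p s"
      using G s by (simp add: field_simps)
    finally show "transfer_function A B (- C) 0 s = poly (p - z) s / poly p s" .
  qed
  then show ?thesis
    using sol B unique by blast
qed

end
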